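(* Let $\mathbf{k}$ be a commutative unital ring with $\mathbb{Q}\subseteq\mathbf{k}$, let $n\ge 1$, and let $L\in M_n(\mathbf{k})$ satisfy $L^2=0$. Let $\mathfrak{m}$ be matrix multiplication, $E$ the identity matrix, and $\Delta_L(M)=ML\otimes L-L\otimes LM$ for $M\in M_n(\mathbf{k})$. Put $D=\mathfrak{m}\circ\Delta_L:M_n(\mathbf{k})\to M_n(\mathbf{k})$. Then $(M_n(\mathbf{k}),\mathfrak{m},E,\Delta_L)$ is an infinitesimal unitary Hopf algebra of weight zero with bijective antipode $$S=-\sum_{i=0}^{\infty}\frac{1}{i!}(-D)^{i}.$$
   Context: Tensor products are over $\mathbf{k}$. For an associative algebra $A$, $A\otimes A$ is an $A$-bimodule via $a\cdot(b\otimes c)=ab\otimes c$ and $(b\otimes c)\cdot a=b\otimes ca$. For $\lambda\in\mathbf{k}$, an infinitesimal unitary bialgebra of weight $\lambda$ is a quadruple $(A,m,1,\Delta)$ where $(A,m,1)$ is a unital associative $\mathbf{k}$-algebra and $\Delta:A\to A\otimes A$ is a coassociative linear map (no counit is required) such that $\Delta(ab)=a\cdot\Delta(b)+\Delta(a)\cdot b+\lambda(a\otimes b)$ for all $a,b\in A$. For linear maps $f,g:A\to A$, the convolution is $f\ast g=m(f\otimes g)\Delta$ and the circular convolution is $f\circledast g=f\ast g+f+g$; the zero map is the unit for $\circledast$. Such a bialgebra is an infinitesimal unitary Hopf algebra of weight $\lambda$ if $\mathrm{id}_A$ is invertible with respect to $\circledast$; its inverse $S$ is the antipode, i.e. in Sweedler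 notation $\sum_{(a)}S(a_{(1)})a_{(2)}+S(a)+a=0=\sum_{(a)}a_{(1)}S(a_{(2)})+a+S(a)$ for all $a\in A$. In the formula for $S$, $(-D)^i$ denotes the $i$-fold composition power, with $(-D)^0=\mathrm{id}$. *)

theory Defs
  imports "HOL-Algebra.AbelCoset" "Jordan_Normal_Form.VS_Connect"
begin

section \<open>Tensor products of modules over a commutative ring\<close>

text \<open>Free modules and tensor products carry no multiplication; their record fields \<open>mult\<close> and
  \<open>one\<close> are left undefined.\<close>

definition free_module :: "('r, 'c) ring_scheme \<Rightarrow> 'x set \<Rightarrow> ('r, 'x \<Rightarrow> 'r) module" where
  "free_module R X =
    \<lparr> carrier = {f. (\<forall>x. f x \<in> carrier R) \<and> (\<forall>x. x \<notin> X \<longrightarrow> f x = \<zero>\<^bsub>R\<^esub>) \<and> finite {x. f x \<noteq> \<zero>\<^bsub>R\<^esub>}},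
      mult = undefined, one = undefined,
      zero = (\<lambda>_. \<zero>\<^bsub>R\<^esub>),
      add = (\<lambda>f g x. f x \<oplus>\<^bsub>R\<^esub> g x),
      smult = (\<lambda>r f x. r \<otimes>\<^bsub>R\<^esub> f x) \<rparr>"

definition free_basis :: "('r, 'c) ring_scheme \<Rightarrow> 'x \<Rightarrow> 'x \<Rightarrow> 'r" where
  "free_basis R x = (\<lambda>y. if y = x then \<one>\<^bsub>R\<^esub> else \<zero>\<^bsub>R\<^esub>)"

definition tensor_relators ::
  "('r, 'c) ring_scheme \<Rightarrow> ('r, 'm, 'd) module_scheme \<Rightarrow> ('r, 'n, 'e) module_scheme \<Rightarrow>
    ('m \<times> 'n \<Rightarrow> 'r) set" where
  "tensor_relators R M N =
    (let F = free_module R (carrier M \<times> carrier N); \<delta> = free_basis R in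
      {\<delta> (x \<oplus>\<^bsub>M\<^esub> x', y) \<ominus>\<^bsub>F\<^esub> (\<delta> (x, y) \<oplus>\<^bsub>F\<^esub> \<delta> (x', y)) | x x' y.
         x \<in> carrier M \<and> x' \<in> carrier M \<and> y \<in> carrier N} \<union>
      {\<delta> (x, y \<oplus>\<^bsub>N\<^esub> y') \<ominus>\<^bsub>F\<^esub> (\<delta> (x, y) \<oplus>\<^bsub>F\<^esub> \<delta> (x, y')) | x y y'.
         x \<in> carrier M \<and> y \<in> carrier N \<and> y' \<in> carrier N} \<union>
      {\<delta> (r \<odot>\<^bsub>M\<^esub> x, y) \<ominus>\<^bsub>F\<^esub> (r \<odot>\<^bsub>F\<^esub> \<delta> (x, y)) | r x y.
         r \<in> carrier R \<and> x \<in> carrier M \<and> y \<in> carrier N} \<union>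
      {\<delta> (x, r \<odot>\<^bsub>N\<^esub> y) \<ominus>\<^bsub>F\<^esub> (r \<odot>\<^bsub>F\<^esub> \<delta> (x, y)) | r x y.
         r \<in> carrier R \<and> x \<in> carrier M \<and> y \<in> carrier N})"

definition tensor_kernel ::
  "('r, 'c) ring_scheme \<Rightarrow> ('r, 'm, 'd) module_scheme \<Rightarrow> ('r, 'n, 'e) module_scheme \<Rightarrow>
    ('m \<times> 'n \<Rightarrow> 'r) set" where
  "tensor_kernel R M N =
    LinearCombinations.module.span R (free_module R (carrier M \<times> carrier N)) (tensor_relators R M N)"

definition tensor ::
  "('r, 'c) ring_scheme \<Rightarrow> ('r, 'm, 'd) module_scheme \<Rightarrow> ('r, 'n, 'e) module_scheme \<Rightarrow>
    ('r, ('m \<times> 'n \<Rightarrow> 'r) set) module" where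
  "tensor R M N =
    (let F = free_module R (carrier M \<times> carrier N); K = tensor_kernel R M N in
      \<lparr> carrier = a_rcosets\<^bsub>F\<^esub> K,
        mult = undefined, one = undefined,
        zero = K,
        add = set_add F,
        smult = (\<lambda>r T. \<Union>f\<in>T. K +>\<^bsub>F\<^esub> (r \<odot>\<^bsub>F\<^esub> f)) \<rparr>)"

definition pure_tensor ::
  "('r, 'c) ring_scheme \<Rightarrow> ('r, 'm, 'd) module_scheme \<Rightarrow> ('r, 'n, 'e) module_scheme \<Rightarrow>
    'm \<Rightarrow> 'n \<Rightarrow> ('m \<times> 'n \<Rightarrow> 'r) set" where
  "pure_tensor R M N x y =
    tensor_kernel R M N +>\<^bsub>free_module R (carrier M \<times> carrier N)\<^esub> free_basis R (x, y)"

text \<open>The linear map out of a tensor product induced by a map \<open>b\<close> into \<open>P\<close>. It is meaningful only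
  for bilinear \<open>b\<close>, in which case the value does not depend on the representative \<open>f\<close> of \<open>T\<close>.\<close>

definition tensor_lift ::
  "('r, 'c) ring_scheme \<Rightarrow> ('r, 'p, 'd) module_scheme \<Rightarrow> ('m \<Rightarrow> 'n \<Rightarrow> 'p) \<Rightarrow>
    ('m \<times> 'n \<Rightarrow> 'r) set \<Rightarrow> 'p" where
  "tensor_lift R P b T =
    (THE p. \<exists>f\<in>T. p = (\<Oplus>\<^bsub>P\<^esub>z\<in>{z. f z \<noteq> \<zero>\<^bsub>R\<^esub>}. f z \<odot>\<^bsub>P\<^esub> b (fst z) (snd z)))"

text \<open>For \<open>f : M \<rightarrow> M'\<close> and \<open>g : N \<rightarrow> N'\<close>, the map \<open>f \<otimes> g\<close>.\<close>

definition tensor_map ::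
  "('r, 'c) ring_scheme \<Rightarrow> ('r, 'm, 'd) module_scheme \<Rightarrow> ('r, 'n, 'e) module_scheme \<Rightarrow>
    ('a \<Rightarrow> 'm) \<Rightarrow> ('b \<Rightarrow> 'n) \<Rightarrow> ('a \<times> 'b \<Rightarrow> 'r) set \<Rightarrow> ('m \<times> 'n \<Rightarrow> 'r) set" where
  "tensor_map R M' N' f g =
    tensor_lift R (tensor R M' N') (\<lambda>x y. pure_tensor R M' N' (f x) (g y))"

text \<open>The canonical map \<open>(M \<otimes> N) \<otimes> P \<rightarrow> M \<otimes> (N \<otimes> P)\<close>.\<close>

definition tensor_assoc ::
  "('r, 'c) ring_scheme \<Rightarrow> ('r, 'm, 'd) module_scheme \<Rightarrow> ('r, 'n, 'e) module_scheme \<Rightarrow>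
    ('r, 'p, 'f) module_scheme \<Rightarrow> (('m \<times> 'n \<Rightarrow> 'r) set \<times> 'p \<Rightarrow> 'r) set \<Rightarrow>
    ('m \<times> ('n \<times> 'p \<Rightarrow> 'r) set \<Rightarrow> 'r) set" where
  "tensor_assoc R M N P =
    (let NP = tensor R N P; MNP = tensor R M NP in
      tensor_lift R MNP (\<lambda>t z. tensor_lift R MNP
        (\<lambda>x y. pure_tensor R M NP x (pure_tensor R N P y z)) t))"


section \<open>Infinitesimal unitary bialgebras and Hopf algebras\<close>

text \<open>The library locale \<open>algebra\<close> is restricted to commutative algebras.\<close>

locale unital_assoc_algebra = Module.module R A + ring A for R (structure) and A (structure) +
  assumes smult_mult_left:
      "\<lbrakk>r \<in> carrier R; a \<in> carrier A; b \<in> carrier A\<rbrakk> \<Longrightarrow>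
        (r \<odot>\<^bsub>A\<^esub> a) \<otimes>\<^bsub>A\<^esub> b = r \<odot>\<^bsub>A\<^esub> (a \<otimes>\<^bsub>A\<^esub> b)"
    and smult_mult_right:
      "\<lbrakk>r \<in> carrier R; a \<in> carrier A; b \<in> carrier A\<rbrakk> \<Longrightarrow>
        a \<otimes>\<^bsub>A\<^esub> (r \<odot>\<^bsub>A\<^esub> b) = r \<odot>\<^bsub>A\<^esub> (a \<otimes>\<^bsub>A\<^esub> b)"

definition mult_map ::
  "('r, 'c) ring_scheme \<Rightarrow> ('r, 'a, 'd) module_scheme \<Rightarrow> ('a \<times> 'a \<Rightarrow> 'r) set \<Rightarrow> 'a" where
  "mult_map R A = tensor_lift R A (\<lambda>a b. a \<otimes>\<^bsub>A\<^esub> b)"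

definition left_action ::
  "('r, 'c) ring_scheme \<Rightarrow> ('r, 'a, 'd) module_scheme \<Rightarrow> 'a \<Rightarrow>
    ('a \<times> 'a \<Rightarrow> 'r) set \<Rightarrow> ('a \<times> 'a \<Rightarrow> 'r) set" where
  "left_action R A a = tensor_lift R (tensor R A A) (\<lambda>b c. pure_tensor R A A (a \<otimes>\<^bsub>A\<^esub> b) c)"

definition right_action ::
  "('r, 'c) ring_scheme \<Rightarrow> ('r, 'a, 'd) module_scheme \<Rightarrow> ('a \<times> 'a \<Rightarrow> 'r) set \<Rightarrow> 'a \<Rightarrow>
    ('a \<times> 'a \<Rightarrow> 'r) set" where
  "right_action R A t a = tensor_lift R (tensor R A A) (\<lambda>b c. pure_tensor R A A b (c \<otimes>\<^bsub>A\<^esub> a)) t"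

locale inf_unitary_bialgebra = unital_assoc_algebra R A for R (structure) and A (structure) +
  fixes \<Delta> :: "'c \<Rightarrow> ('c \<times> 'c \<Rightarrow> 'a) set" and wt :: 'a
  assumes weight_closed: "wt \<in> carrier R"
    and coproduct_linear: "\<Delta> \<in> LinearCombinations.module_hom R A (tensor R A A)"
    and coassoc: "a \<in> carrier A \<Longrightarrow>
      tensor_assoc R A A A (tensor_map R (tensor R A A) A \<Delta> id (\<Delta> a)) =
      tensor_map R A (tensor R A A) id \<Delta> (\<Delta> a)"
    and coproduct_mult: "\<lbrakk>a \<in> carrier A; b \<in> carrier A\<rbrakk> \<Longrightarrow>
      \<Delta> (a \<otimes>\<^bsub>A\<^esub> b) =
        left_action R A a (\<Delta> b) \<oplus>\<^bsub>tensor R A A\<^esub> right_action R A (\<Delta> a) b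
          \<oplus>\<^bsub>tensor R A A\<^esub> wt \<odot>\<^bsub>tensor R A A\<^esub> pure_tensor R A A a b"

definition convolution ::
  "('r, 'c) ring_scheme \<Rightarrow> ('r, 'a, 'd) module_scheme \<Rightarrow> ('a \<Rightarrow> ('a \<times> 'a \<Rightarrow> 'r) set) \<Rightarrow>
    ('a \<Rightarrow> 'a) \<Rightarrow> ('a \<Rightarrow> 'a) \<Rightarrow> 'a \<Rightarrow> 'a" where
  "convolution R A \<Delta> f g a = mult_map R A (tensor_map R A A f g (\<Delta> a))"

definition circ_convolution ::
  "('r, 'c) ring_scheme \<Rightarrow> ('r, 'a, 'd) module_scheme \<Rightarrow> ('a \<Rightarrow> ('a \<times> 'a \<Rightarrow> 'r) set) \<Rightarrow>
    ('a \<Rightarrow> 'a) \<Rightarrow> ('a \<Rightarrow> 'a) \<Rightarrow> 'a \<Rightarrow> 'a" where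
  "circ_convolution R A \<Delta> f g a = convolution R A \<Delta> f g a \<oplus>\<^bsub>A\<^esub> f a \<oplus>\<^bsub>A\<^esub> g a"

text \<open>A two-sided inverse of the identity for the circular convolution, whose unit is the zero map.\<close>

definition is_antipode ::
  "('r, 'c) ring_scheme \<Rightarrow> ('r, 'a, 'd) module_scheme \<Rightarrow> ('a \<Rightarrow> ('a \<times> 'a \<Rightarrow> 'r) set) \<Rightarrow>
    ('a \<Rightarrow> 'a) \<Rightarrow> bool" where
  "is_antipode R A \<Delta> S \<longleftrightarrow>
    S \<in> LinearCombinations.module_hom R A A \<and>
    (\<forall>a\<in>carrier A. circ_convolution R A \<Delta> S id a = \<zero>\<^bsub>A\<^esub>) \<and>
    (\<forall>a\<in>carrier A. circ_convolution R A \<Delta> id S a = \<zero>\<^bsub>A\<^esub>)"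

locale inf_unitary_hopf_algebra = inf_unitary_bialgebra +
  assumes antipode_exists: "\<exists>S. is_antipode R A \<Delta> S"


section \<open>The coproduct on matrices\<close>

text \<open>The record \<open>module_mat TYPE('k) n n\<close> has the matrix product and the identity matrix as
  \<open>mult\<close> and \<open>one\<close>, so it is the full matrix algebra.\<close>

definition mat_coproduct ::
  "nat \<Rightarrow> 'k :: comm_ring_1 mat \<Rightarrow> 'k mat \<Rightarrow> ('k mat \<times> 'k mat \<Rightarrow> 'k) set" where
  "mat_coproduct n L M =
    (let R = class_ring; A = module_mat TYPE('k) n n in
      pure_tensor R A A (M * L) L \<ominus>\<^bsub>tensor R A A\<^esub> pure_tensor R A A L (L * M))"

end

theory Submission
  imports Defs
begin

text \<open>Since \<open>L\<^sup>2 = 0\<close>, the map \<open>D\<close> vanishes: \<open>D(M) = M L L - L L M = 0\<close>. The series for \<open>S\<close> therefore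
  reduces to its term of index \<open>0\<close> and \<open>S = - id\<close>, which is bijective. Moreover
  \<open>\<Delta>(L) = 0\<close>, so both sides of coassociativity collapse to \<open>- L \<otimes> L M L \<otimes> L\<close>, and in
  \<open>M \<cdot> \<Delta>(N) + \<Delta>(M) \<cdot> N\<close> the two middle terms \<open>M L \<otimes> L N\<close> cancel. Only
  \<open>L\<^sup>2 = 0\<close> matters here, so matrices can be replaced by any unital algebra.\<close>

section \<open>Bilinear maps\<close>

text \<open>This is the condition under which \<open>tensor_lift\<close> is meaningful. As a locale,
  each bilinear map brings along the linear map it induces on the tensor product and the rules for
  evaluating it.\<close>

locale bilinear_map = M: Module.module R M + N: Module.module R N + P: Module.module R P
  for R :: "('r, 'c) ring_scheme" (structure)
    and M :: "('r, 'm, 'd) module_scheme" (structure)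
    and N :: "('r, 'n, 'e) module_scheme" (structure)
    and P :: "('r, 'p, 'f) module_scheme" (structure) +
  fixes b :: "'m \<Rightarrow> 'n \<Rightarrow> 'p"
  assumes closed [simp, intro]: "\<lbrakk>x \<in> carrier M; y \<in> carrier N\<rbrakk> \<Longrightarrow> b x y \<in> carrier P"
    and add_left: "\<lbrakk>x \<in> carrier M; x' \<in> carrier M; y \<in> carrier N\<rbrakk> \<Longrightarrow>
      b (x \<oplus>\<^bsub>M\<^esub> x') y = b x y \<oplus>\<^bsub>P\<^esub> b x' y"
    and add_right: "\<lbrakk>x \<in> carrier M; y \<in> carrier N; y' \<in> carrier N\<rbrakk> \<Longrightarrow>
      b x (y \<oplus>\<^bsub>N\<^esub> y') = b x y \<oplus>\<^bsub>P\<^esub> b x y'"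
    and smult_left: "\<lbrakk>r \<in> carrier R; x \<in> carrier M; y \<in> carrier N\<rbrakk> \<Longrightarrow>
      b (r \<odot>\<^bsub>M\<^esub> x) y = r \<odot>\<^bsub>P\<^esub> b x y"
    and smult_right: "\<lbrakk>r \<in> carrier R; x \<in> carrier M; y \<in> carrier N\<rbrakk> \<Longrightarrow>
      b x (r \<odot>\<^bsub>N\<^esub> y) = r \<odot>\<^bsub>P\<^esub> b x y"
begin

text \<open>Fixing one argument leaves a linear map, so the rules for zero and negation below are
  inherited from \<open>mod_hom\<close>.\<close>

lemma hom_left: "y \<in> carrier N \<Longrightarrow> (\<lambda>x. b x y) \<in> LinearCombinations.module_hom R M P"
  by (auto simp: LinearCombinations.module_hom_def add_left smult_left)

lemma hom_right: "x \<in> carrier M \<Longrightarrow> b x \<in> LinearCombinations.module_hom R N P"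
  by (auto simp: LinearCombinations.module_hom_def add_right smult_right)

lemma mod_hom_left: "y \<in> carrier N \<Longrightarrow> mod_hom R M P (\<lambda>x. b x y)"
  by (intro mod_hom.intro mod_hom_axioms.intro M.module_axioms P.module_axioms hom_left)

lemma mod_hom_right: "x \<in> carrier M \<Longrightarrow> mod_hom R N P (b x)"
  by (intro mod_hom.intro mod_hom_axioms.intro N.module_axioms P.module_axioms hom_right)

lemma zero_left: "y \<in> carrier N \<Longrightarrow> b \<zero>\<^bsub>M\<^esub> y = \<zero>\<^bsub>P\<^esub>"
  using mod_hom.f0_is_0 [OF mod_hom_left] .

lemma zero_right: "x \<in> carrier M \<Longrightarrow> b x \<zero>\<^bsub>N\<^esub> = \<zero>\<^bsub>P\<^esub>"
  using mod_hom.f0_is_0 [OF mod_hom_right] .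

lemma minus_left: "\<lbrakk>x \<in> carrier M; y \<in> carrier N\<rbrakk> \<Longrightarrow> b (\<ominus>\<^bsub>M\<^esub> x) y = \<ominus>\<^bsub>P\<^esub> b x y"
  using mod_hom.f_neg [OF mod_hom_left] .

end

section \<open>Free modules\<close>

lemma free_module_simps:
  "zero (free_module R X) = (\<lambda>_. \<zero>\<^bsub>R\<^esub>)"
  "add (free_module R X) = (\<lambda>f g x. f x \<oplus>\<^bsub>R\<^esub> g x)"
  "smult (free_module R X) = (\<lambda>r f x. r \<otimes>\<^bsub>R\<^esub> f x)"
  by (simp_all add: free_module_def)

text \<open>Phrased through the support, so that closure under the operations reduces to inclusions
  between supports.\<close>

lemma free_module_carrier_iff:
  "f \<in> carrier (free_module R X) \<longleftrightarrow>
    (\<forall>x. f x \<in> carrier R) \<and> {x. f x \<noteq> \<zero>\<^bsub>R\<^esub>} \<subseteq> X \<and> finite {x. f x \<noteq> \<zero>\<^bsub>R\<^esub>}"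
  by (auto simp: free_module_def)

context cring
begin

lemma free_module_add_closed:
  assumes "f \<in> carrier (free_module R X)" "g \<in> carrier (free_module R X)"
  shows "(\<lambda>x. f x \<oplus> g x) \<in> carrier (free_module R X)"
proof -
  have "{x. f x \<oplus> g x \<noteq> \<zero>} \<subseteq> {x. f x \<noteq> \<zero>} \<union> {x. g x \<noteq> \<zero>}"
    by auto
  with assms show ?thesis
    unfolding free_module_carrier_iff by (blast intro: finite_subset)
qed

lemma free_module_smult_closed:
  assumes "r \<in> carrier R" "f \<in> carrier (free_module R X)"
  shows "(\<lambda>x. r \<otimes> f x) \<in> carrier (free_module R X)"
proof -
  have "{x. r \<otimes> f x \<noteq> \<zero>} \<subseteq> {x. f x \<noteq> \<zero>}"
    using assms(1) by auto
  with assms show ?thesis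
    unfolding free_module_carrier_iff by (blast intro: finite_subset)
qed

lemma free_module_module: "Module.module R (free_module R X)"
proof (intro moduleI)
  show "abelian_group (free_module R X)"
  proof (rule abelian_groupI)
    fix f assume f: "f \<in> carrier (free_module R X)"
    show "\<exists>g\<in>carrier (free_module R X). g \<oplus>\<^bsub>free_module R X\<^esub> f = \<zero>\<^bsub>free_module R X\<^esub>"
    proof
      \<comment> \<open>Writing the negative as a multiple by \<open>\<ominus> \<one>\<close> makes
        its membership an instance of closure under scalars.\<close>
      show "(\<lambda>x. \<ominus> \<one> \<otimes> f x) \<in> carrier (free_module R X)"
        using f by (intro free_module_smult_closed) auto
      show "(\<lambda>x. \<ominus> \<one> \<otimes> f x) \<oplus>\<^bsub>free_module R X\<^esub> f = \<zero>\<^bsub>free_module R X\<^esub>"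
        using f by (auto simp: free_module_carrier_iff free_module_simps l_minus l_neg)
    qed
  next
    show "f \<oplus>\<^bsub>free_module R X\<^esub> g \<in> carrier (free_module R X)"
      if "f \<in> carrier (free_module R X)" "g \<in> carrier (free_module R X)" for f g
      using free_module_add_closed [OF that] by (simp add: free_module_simps)
  qed (auto simp: free_module_carrier_iff free_module_simps fun_eq_iff a_ac)
next
  show "r \<odot>\<^bsub>free_module R X\<^esub> f \<in> carrier (free_module R X)"
    if "r \<in> carrier R" "f \<in> carrier (free_module R X)" for r f
    using free_module_smult_closed [OF that] by (simp add: free_module_simps)
qed (auto simp: free_module_carrier_iff free_module_simps l_distr r_distr m_assoc is_cring fun_eq_iff)

lemma free_basis_closed: "x \<in> X \<Longrightarrow> free_basis R x \<in> carrier (free_module R X)"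
  by (auto simp: free_module_carrier_iff free_basis_def intro: finite_subset [of _ "{x}"])

end

section \<open>Linear extension from the basis of a free module\<close>

definition free_lift ::
  "('r, 'c) ring_scheme \<Rightarrow> ('r, 'p, 'd) module_scheme \<Rightarrow> ('x \<Rightarrow> 'p) \<Rightarrow> ('x \<Rightarrow> 'r) \<Rightarrow> 'p" where
  "free_lift R P b f = (\<Oplus>\<^bsub>P\<^esub>z\<in>{z. f z \<noteq> \<zero>\<^bsub>R\<^esub>}. f z \<odot>\<^bsub>P\<^esub> b z)"

context Module.module
begin

text \<open>Each sum in \<open>free_lift\<close> runs over the support of its own argument. Terms
  outside the support are zero, so sums for different arguments can be moved to a common finite set
  \<open>A\<close> and compared term by term.\<close>

lemma free_lift_eq_finsum:
  assumes f: "f \<in> carrier (free_module R X)" and b: "b \<in> X \<rightarrow> carrier M"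
    and A: "finite A" "{z. f z \<noteq> \<zero>} \<subseteq> A" "A \<subseteq> X"
  shows "free_lift R M b f = (\<Oplus>\<^bsub>M\<^esub>z\<in>A. f z \<odot>\<^bsub>M\<^esub> b z)"
  unfolding free_lift_def
proof (rule add.finprod_mono_neutral_cong_left)
  show "(\<lambda>z. f z \<odot>\<^bsub>M\<^esub> b z) \<in> A \<rightarrow> carrier M"
    using f b A by (auto simp: free_module_carrier_iff intro!: smult_closed)
  show "f z \<odot>\<^bsub>M\<^esub> b z = \<zero>\<^bsub>M\<^esub>" if "z \<in> A - {z. f z \<noteq> \<zero>}" for z
    using that b A(3) by (auto intro!: smult_l_null)
qed (use A in auto)

lemma free_lift_hom:
  assumes b: "b \<in> X \<rightarrow> carrier M"
  shows "free_lift R M b \<in> LinearCombinations.module_hom R (free_module R X) M"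
proof -
  let ?F = "free_module R X"
  interpret F: Module.module R ?F by (rule R.free_module_module)
  have closed: "free_lift R M b f \<in> carrier M" if "f \<in> carrier ?F" for f
    using that b unfolding free_lift_def
    by (intro M.finsum_closed) (auto simp: free_module_carrier_iff)
  have add: "free_lift R M b (f \<oplus>\<^bsub>?F\<^esub> g) = free_lift R M b f \<oplus>\<^bsub>M\<^esub> free_lift R M b g"
    if f: "f \<in> carrier ?F" and g: "g \<in> carrier ?F" for f g
  proof -
    \<comment> \<open>Cancellation can make the support of the sum smaller than this union, so all
      three sums are taken over \<open>A\<close>.\<close>
    define A where "A = {z. f z \<noteq> \<zero>} \<union> {z. g z \<noteq> \<zero>}"
    have A: "finite A" "A \<subseteq> X" "{z. f z \<noteq> \<zero>} \<subseteq> A" "{z. g z \<noteq> \<zero>} \<subseteq> A"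
      "{z. (f \<oplus>\<^bsub>?F\<^esub> g) z \<noteq> \<zero>} \<subseteq> A"
      using f g by (auto simp: A_def free_module_carrier_iff free_module_simps)
    have c: "f z \<in> carrier R" "g z \<in> carrier R" for z
      using f g by (auto simp: free_module_carrier_iff)
    have bz: "z \<in> A \<Longrightarrow> b z \<in> carrier M" for z
      using b A(2) by auto
    have "free_lift R M b (f \<oplus>\<^bsub>?F\<^esub> g) = (\<Oplus>\<^bsub>M\<^esub>z\<in>A. (f \<oplus>\<^bsub>?F\<^esub> g) z \<odot>\<^bsub>M\<^esub> b z)"
      by (rule free_lift_eq_finsum [OF F.add.m_closed [OF f g] b A(1,5,2)])
    also have "\<dots> = (\<Oplus>\<^bsub>M\<^esub>z\<in>A. f z \<odot>\<^bsub>M\<^esub> b z \<oplus>\<^bsub>M\<^esub> g z \<odot>\<^bsub>M\<^esub> b z)"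
      by (rule M.finsum_cong') (auto simp: free_module_simps smult_l_distr c bz)
    also have "\<dots> = (\<Oplus>\<^bsub>M\<^esub>z\<in>A. f z \<odot>\<^bsub>M\<^esub> b z) \<oplus>\<^bsub>M\<^esub> (\<Oplus>\<^bsub>M\<^esub>z\<in>A. g z \<odot>\<^bsub>M\<^esub> b z)"
      by (rule M.finsum_addf) (auto simp: c bz)
    finally show ?thesis
      using free_lift_eq_finsum [OF f b A(1,3,2)] free_lift_eq_finsum [OF g b A(1,4,2)] by simp
  qed
  have smult: "free_lift R M b (r \<odot>\<^bsub>?F\<^esub> f) = r \<odot>\<^bsub>M\<^esub> free_lift R M b f"
    if r: "r \<in> carrier R" and f: "f \<in> carrier ?F" for r f
  proof -
    define A where "A = {z. f z \<noteq> \<zero>}"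
    have A: "finite A" "A \<subseteq> X" "{z. f z \<noteq> \<zero>} \<subseteq> A" "{z. (r \<odot>\<^bsub>?F\<^esub> f) z \<noteq> \<zero>} \<subseteq> A"
      using f r by (auto simp: A_def free_module_carrier_iff free_module_simps)
    have c: "f z \<in> carrier R" for z
      using f by (auto simp: free_module_carrier_iff)
    have bz: "z \<in> A \<Longrightarrow> b z \<in> carrier M" for z
      using b A(2) by auto
    have "free_lift R M b (r \<odot>\<^bsub>?F\<^esub> f) = (\<Oplus>\<^bsub>M\<^esub>z\<in>A. (r \<odot>\<^bsub>?F\<^esub> f) z \<odot>\<^bsub>M\<^esub> b z)"
      by (rule free_lift_eq_finsum [OF F.smult_closed [OF r f] b A(1,4,2)])
    also have "\<dots> = (\<Oplus>\<^bsub>M\<^esub>z\<in>A. r \<odot>\<^bsub>M\<^esub> (f z \<odot>\<^bsub>M\<^esub> b z))"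
      by (rule M.finsum_cong') (auto simp: free_module_simps smult_assoc1 c bz r)
    also have "\<dots> = r \<odot>\<^bsub>M\<^esub> (\<Oplus>\<^bsub>M\<^esub>z\<in>A. f z \<odot>\<^bsub>M\<^esub> b z)"
      by (rule finsum_smult_ldistr [symmetric]) (auto simp: c bz r A)
    finally show ?thesis
      using free_lift_eq_finsum [OF f b A(1,3,2)] by simp
  qed
  show ?thesis
    using closed add smult by (auto simp: LinearCombinations.module_hom_def)
qed

lemma free_lift_basis:
  assumes "b \<in> X \<rightarrow> carrier M" "x \<in> X"
  shows "free_lift R M b (free_basis R x) = b x"
proof -
  have "free_lift R M b (free_basis R x) = (\<Oplus>\<^bsub>M\<^esub>z\<in>{x}. free_basis R x z \<odot>\<^bsub>M\<^esub> b z)"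
    using assms
    by (intro free_lift_eq_finsum [OF R.free_basis_closed]) (auto simp: free_basis_def)
  with assms show ?thesis
    by (simp add: free_basis_def Pi_iff)
qed

text \<open>Here the argument \<open>f\<close> is fixed and the map varies. Together with
  \<open>free_lift_smult\<close> this gives linearity in the third factor in
  \<open>tensor_assoc_bilinear\<close>.\<close>

lemma free_lift_add:
  assumes f: "f \<in> carrier (free_module R X)" and "b \<in> X \<rightarrow> carrier M" "c \<in> X \<rightarrow> carrier M"
  shows "free_lift R M (\<lambda>z. b z \<oplus>\<^bsub>M\<^esub> c z) f = free_lift R M b f \<oplus>\<^bsub>M\<^esub> free_lift R M c f"
proof -
  have fz: "f z \<in> carrier R" for z
    using f by (auto simp: free_module_carrier_iff)
  have bc: "b z \<in> carrier M" "c z \<in> carrier M" if "f z \<noteq> \<zero>" for z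
    using assms that by (auto simp: free_module_carrier_iff)
  have "free_lift R M (\<lambda>z. b z \<oplus>\<^bsub>M\<^esub> c z) f
      = (\<Oplus>\<^bsub>M\<^esub>z\<in>{z. f z \<noteq> \<zero>}. f z \<odot>\<^bsub>M\<^esub> b z \<oplus>\<^bsub>M\<^esub> f z \<odot>\<^bsub>M\<^esub> c z)"
    unfolding free_lift_def by (rule M.finsum_cong') (auto simp: smult_r_distr fz bc)
  also have "\<dots> = free_lift R M b f \<oplus>\<^bsub>M\<^esub> free_lift R M c f"
    unfolding free_lift_def by (rule M.finsum_addf) (auto simp: fz bc)
  finally show ?thesis .
qed

lemma free_lift_smult:
  assumes f: "f \<in> carrier (free_module R X)" and "b \<in> X \<rightarrow> carrier M" and r: "r \<in> carrier R"
  shows "free_lift R M (\<lambda>z. r \<odot>\<^bsub>M\<^esub> b z) f = r \<odot>\<^bsub>M\<^esub> free_lift R M b f"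
proof -
  have fz: "f z \<in> carrier R" for z
    using f by (auto simp: free_module_carrier_iff)
  have bz: "b z \<in> carrier M" if "f z \<noteq> \<zero>" for z
    using assms that by (auto simp: free_module_carrier_iff)
  \<comment> \<open>Commutativity of \<open>R\<close> lets \<open>r\<close> pass the coefficient
    \<open>f z\<close>.\<close>
  have "free_lift R M (\<lambda>z. r \<odot>\<^bsub>M\<^esub> b z) f = (\<Oplus>\<^bsub>M\<^esub>z\<in>{z. f z \<noteq> \<zero>}. r \<odot>\<^bsub>M\<^esub> (f z \<odot>\<^bsub>M\<^esub> b z))"
    unfolding free_lift_def
    by (rule M.finsum_cong') (auto simp: fz bz r m_comm simp flip: smult_assoc1)
  also have "\<dots> = r \<odot>\<^bsub>M\<^esub> free_lift R M b f"
    unfolding free_lift_def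
    using f by (intro finsum_smult_ldistr [symmetric]) (auto simp: fz bz r free_module_carrier_iff)
  finally show ?thesis .
qed

lemma free_lift_cong:
  assumes f: "f \<in> carrier (free_module R X)" and "c \<in> X \<rightarrow> carrier M"
    and "\<And>z. z \<in> X \<Longrightarrow> b z = c z"
  shows "free_lift R M b f = free_lift R M c f"
  unfolding free_lift_def
  by (rule M.finsum_cong') (use assms in \<open>auto simp: free_module_carrier_iff intro!: smult_closed\<close>)

end

section \<open>Tensor products\<close>

locale tensor_product = M: Module.module R M + N: Module.module R N
  for R :: "('r, 'c) ring_scheme" (structure)
    and M :: "('r, 'm, 'd) module_scheme" (structure)
    and N :: "('r, 'n, 'e) module_scheme" (structure)
begin

abbreviation "F \<equiv> free_module R (carrier M \<times> carrier N)"
abbreviation "K \<equiv> tensor_kernel R M N"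
abbreviation "T \<equiv> tensor R M N"
abbreviation "\<delta> \<equiv> free_basis R"

sublocale F: Module.module R F
  by (rule M.R.free_module_module)

lemma free_basis_pair_closed [simp]:
  "\<lbrakk>x \<in> carrier M; y \<in> carrier N\<rbrakk> \<Longrightarrow> \<delta> (x, y) \<in> carrier F"
  by (rule M.R.free_basis_closed) simp

lemma tensor_relators_closed: "tensor_relators R M N \<subseteq> carrier F"
  unfolding tensor_relators_def Let_def by auto

lemma tensor_relatorI:
  "\<lbrakk>x \<in> carrier M; x' \<in> carrier M; y \<in> carrier N\<rbrakk> \<Longrightarrow>
    \<delta> (x \<oplus>\<^bsub>M\<^esub> x', y) \<ominus>\<^bsub>F\<^esub> (\<delta> (x, y) \<oplus>\<^bsub>F\<^esub> \<delta> (x', y)) \<in> tensor_relators R M N"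
  "\<lbrakk>x \<in> carrier M; y \<in> carrier N; y' \<in> carrier N\<rbrakk> \<Longrightarrow>
    \<delta> (x, y \<oplus>\<^bsub>N\<^esub> y') \<ominus>\<^bsub>F\<^esub> (\<delta> (x, y) \<oplus>\<^bsub>F\<^esub> \<delta> (x, y')) \<in> tensor_relators R M N"
  "\<lbrakk>r \<in> carrier R; x \<in> carrier M; y \<in> carrier N\<rbrakk> \<Longrightarrow>
    \<delta> (r \<odot>\<^bsub>M\<^esub> x, y) \<ominus>\<^bsub>F\<^esub> (r \<odot>\<^bsub>F\<^esub> \<delta> (x, y)) \<in> tensor_relators R M N"
  "\<lbrakk>r \<in> carrier R; x \<in> carrier M; y \<in> carrier N\<rbrakk> \<Longrightarrow>
    \<delta> (x, r \<odot>\<^bsub>N\<^esub> y) \<ominus>\<^bsub>F\<^esub> (r \<odot>\<^bsub>F\<^esub> \<delta> (x, y)) \<in> tensor_relators R M N"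
  unfolding tensor_relators_def Let_def by blast+

lemma tensor_kernel_submodule: "submodule R K F"
  unfolding tensor_kernel_def by (rule F.span_is_submodule [OF tensor_relators_closed])

lemma tensor_relators_subset_kernel: "tensor_relators R M N \<subseteq> K"
  unfolding tensor_kernel_def by (rule F.in_own_span [OF tensor_relators_closed])

text \<open>The coset calculus of the library is available for an \<open>abelian_subgroup\<close>.
  Closure of the submodule under negation comes from scaling by
  \<open>\<ominus> \<one>\<close>.\<close>

lemma tensor_kernel_abelian_subgroup: "abelian_subgroup K F"
proof (intro abelian_subgroupI3 additive_subgroupI F.abelian_group_axioms)
  interpret K: submodule R K F by (rule tensor_kernel_submodule)
  show "subgroup K (add_monoid F)"
  proof (rule group.subgroupI [OF F.a_group])
    fix f assume f: "f \<in> K"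
    then have "\<ominus>\<^bsub>F\<^esub> f = (\<ominus> \<one>) \<odot>\<^bsub>F\<^esub> f"
      using K.subset by (auto simp: F.smult_l_minus)
    with f have "\<ominus>\<^bsub>F\<^esub> f \<in> K" by simp
    then show "inv\<^bsub>add_monoid F\<^esub> f \<in> K" by (simp add: a_inv_def)
  next
    show "K \<noteq> {}" using K.zero_closed by blast
  qed (use K.subset in auto)
qed

sublocale K: abelian_subgroup K F
  by (rule tensor_kernel_abelian_subgroup)

lemma tensor_cosetE:
  assumes "t \<in> carrier T"
  obtains f where "f \<in> carrier F" "t = K +>\<^bsub>F\<^esub> f"
  using assms by (auto simp: tensor_def Let_def A_RCOSETS_def')

lemma tensor_coset_closed [simp]: "f \<in> carrier F \<Longrightarrow> K +>\<^bsub>F\<^esub> f \<in> carrier T"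
  by (auto simp: tensor_def Let_def A_RCOSETS_def')

lemma tensor_coset_add:
  "\<lbrakk>f \<in> carrier F; g \<in> carrier F\<rbrakk> \<Longrightarrow> (K +>\<^bsub>F\<^esub> f) \<oplus>\<^bsub>T\<^esub> (K +>\<^bsub>F\<^esub> g) = K +>\<^bsub>F\<^esub> (f \<oplus>\<^bsub>F\<^esub> g)"
  using K.a_rcos_sum by (simp add: tensor_def Let_def)

lemma tensor_zero: "\<zero>\<^bsub>T\<^esub> = K +>\<^bsub>F\<^esub> \<zero>\<^bsub>F\<^esub>"
  using F.a_coset_add_zero [OF K.a_subset] by (simp add: tensor_def Let_def)

lemma tensor_coset_eqI:
  assumes "k \<in> K" "f \<in> carrier F"
  shows "K +>\<^bsub>F\<^esub> (k \<oplus>\<^bsub>F\<^esub> f) = K +>\<^bsub>F\<^esub> f"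
  using assms F.a_coset_add_assoc [OF K.a_subset, of k f] K.a_rcos_const [of k] by simp

text \<open>Scaling in \<open>tensor\<close> is a union over all representatives of a coset. Since
  \<open>K\<close> is closed under scalars, every representative contributes the same coset.\<close>

lemma tensor_coset_smult:
  assumes r: "r \<in> carrier R" and f: "f \<in> carrier F"
  shows "r \<odot>\<^bsub>T\<^esub> (K +>\<^bsub>F\<^esub> f) = K +>\<^bsub>F\<^esub> (r \<odot>\<^bsub>F\<^esub> f)"
proof -
  interpret K': submodule R K F by (rule tensor_kernel_submodule)
  have eq: "K +>\<^bsub>F\<^esub> (r \<odot>\<^bsub>F\<^esub> g) = K +>\<^bsub>F\<^esub> (r \<odot>\<^bsub>F\<^esub> f)" if "g \<in> K +>\<^bsub>F\<^esub> f" for g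
  proof -
    from that obtain k where k: "k \<in> K" and g: "g = k \<oplus>\<^bsub>F\<^esub> f"
      by (auto simp: a_r_coset_def')
    have "r \<odot>\<^bsub>F\<^esub> g = r \<odot>\<^bsub>F\<^esub> k \<oplus>\<^bsub>F\<^esub> r \<odot>\<^bsub>F\<^esub> f"
      using r f k by (simp add: g F.smult_r_distr)
    then show ?thesis
      using r f k by (simp add: tensor_coset_eqI)
  qed
  have "r \<odot>\<^bsub>T\<^esub> (K +>\<^bsub>F\<^esub> f) = (\<Union>g\<in>K +>\<^bsub>F\<^esub> f. K +>\<^bsub>F\<^esub> (r \<odot>\<^bsub>F\<^esub> g))"
    by (simp add: tensor_def Let_def)
  also have "\<dots> = (\<Union>g\<in>K +>\<^bsub>F\<^esub> f. K +>\<^bsub>F\<^esub> (r \<odot>\<^bsub>F\<^esub> f))"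
    by (rule SUP_cong [OF refl eq])
  \<comment> \<open>A constant union collapses to its value once the index set is nonempty, and
    \<open>f\<close> lies in its own coset.\<close>
  also have "\<dots> = K +>\<^bsub>F\<^esub> (r \<odot>\<^bsub>F\<^esub> f)"
    using K.a_rcos_self [OF f] by auto
  finally show ?thesis .
qed

lemma tensor_module: "Module.module R T"
proof (rule moduleI)
  show "abelian_group T"
  proof (rule abelian_groupI)
    fix t assume "t \<in> carrier T"
    then obtain f where f: "f \<in> carrier F" and t: "t = K +>\<^bsub>F\<^esub> f"
      by (rule tensor_cosetE)
    show "\<exists>u\<in>carrier T. u \<oplus>\<^bsub>T\<^esub> t = \<zero>\<^bsub>T\<^esub>"
      by (rule bexI [of _ "K +>\<^bsub>F\<^esub> (\<ominus>\<^bsub>F\<^esub> f)"])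
        (use f in \<open>simp_all add: t tensor_coset_add tensor_zero F.l_neg\<close>)
  qed (auto elim!: tensor_cosetE simp: tensor_coset_add tensor_zero F.a_ac)
qed (auto elim!: tensor_cosetE
    simp: tensor_coset_smult tensor_coset_add F.smult_l_distr F.smult_r_distr F.smult_assoc1
      M.R.is_cring)

sublocale T: Module.module R T
  by (rule tensor_module)

text \<open>Relators lie in \<open>K\<close>, so the two sides of each become equal in the quotient.
  The four families of relators thereby turn into the four bilinearity laws of the pure
  tensor.\<close>

lemma tensor_coset_eq_if_relator:
  assumes "f \<ominus>\<^bsub>F\<^esub> g \<in> tensor_relators R M N" and f: "f \<in> carrier F" and g: "g \<in> carrier F"
  shows "K +>\<^bsub>F\<^esub> f = K +>\<^bsub>F\<^esub> g"
proof -
  have "f \<ominus>\<^bsub>F\<^esub> g \<in> K"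
    using assms(1) tensor_relators_subset_kernel by auto
  then have "K +>\<^bsub>F\<^esub> ((f \<ominus>\<^bsub>F\<^esub> g) \<oplus>\<^bsub>F\<^esub> g) = K +>\<^bsub>F\<^esub> g"
    by (rule tensor_coset_eqI [OF _ g])
  with f g show ?thesis
    by (simp add: a_minus_def F.a_assoc F.l_neg)
qed

lemma pure_tensor_bilinear: "bilinear_map R M N T (pure_tensor R M N)"
proof (intro bilinear_map.intro bilinear_map_axioms.intro M.module_axioms N.module_axioms
    tensor_module)
  fix x x' y assume xy: "x \<in> carrier M" "x' \<in> carrier M" "y \<in> carrier N"
  have "K +>\<^bsub>F\<^esub> \<delta> (x \<oplus>\<^bsub>M\<^esub> x', y) = K +>\<^bsub>F\<^esub> (\<delta> (x, y) \<oplus>\<^bsub>F\<^esub> \<delta> (x', y))"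
    by (rule tensor_coset_eq_if_relator) (use xy in \<open>auto intro: tensor_relatorI\<close>)
  with xy show "pure_tensor R M N (x \<oplus>\<^bsub>M\<^esub> x') y = pure_tensor R M N x y \<oplus>\<^bsub>T\<^esub> pure_tensor R M N x' y"
    by (simp add: pure_tensor_def tensor_coset_add)
next
  fix x y y' assume xy: "x \<in> carrier M" "y \<in> carrier N" "y' \<in> carrier N"
  have "K +>\<^bsub>F\<^esub> \<delta> (x, y \<oplus>\<^bsub>N\<^esub> y') = K +>\<^bsub>F\<^esub> (\<delta> (x, y) \<oplus>\<^bsub>F\<^esub> \<delta> (x, y'))"
    by (rule tensor_coset_eq_if_relator) (use xy in \<open>auto intro: tensor_relatorI\<close>)
  with xy show "pure_tensor R M N x (y \<oplus>\<^bsub>N\<^esub> y') = pure_tensor R M N x y \<oplus>\<^bsub>T\<^esub> pure_tensor R M N x y'"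
    by (simp add: pure_tensor_def tensor_coset_add)
next
  fix r x y assume xy: "r \<in> carrier R" "x \<in> carrier M" "y \<in> carrier N"
  have "K +>\<^bsub>F\<^esub> \<delta> (r \<odot>\<^bsub>M\<^esub> x, y) = K +>\<^bsub>F\<^esub> (r \<odot>\<^bsub>F\<^esub> \<delta> (x, y))"
    by (rule tensor_coset_eq_if_relator) (use xy in \<open>auto intro: tensor_relatorI\<close>)
  with xy show "pure_tensor R M N (r \<odot>\<^bsub>M\<^esub> x) y = r \<odot>\<^bsub>T\<^esub> pure_tensor R M N x y"
    by (simp add: pure_tensor_def tensor_coset_smult)
  have "K +>\<^bsub>F\<^esub> \<delta> (x, r \<odot>\<^bsub>N\<^esub> y) = K +>\<^bsub>F\<^esub> (r \<odot>\<^bsub>F\<^esub> \<delta> (x, y))"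
    by (rule tensor_coset_eq_if_relator) (use xy in \<open>auto intro: tensor_relatorI\<close>)
  with xy show "pure_tensor R M N x (r \<odot>\<^bsub>N\<^esub> y) = r \<odot>\<^bsub>T\<^esub> pure_tensor R M N x y"
    by (simp add: pure_tensor_def tensor_coset_smult)
qed (simp add: pure_tensor_def)

end

section \<open>The universal property\<close>

context bilinear_map
begin

sublocale tensor_product R M N ..

abbreviation "b' \<equiv> \<lambda>z. b (fst z) (snd z)"

sublocale lift: mod_hom R F P "free_lift R P b'"
  by (intro mod_hom.intro mod_hom_axioms.intro F.module_axioms P.module_axioms P.free_lift_hom) auto

lemma free_lift_pair:
  "\<lbrakk>x \<in> carrier M; y \<in> carrier N\<rbrakk> \<Longrightarrow> free_lift R P b' (\<delta> (x, y)) = b x y"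
  by (subst P.free_lift_basis [where X = "carrier M \<times> carrier N"]) auto

text \<open>A kernel is a submodule, so it contains the span of the relators as soon as it contains
  the relators; on each of these the vanishing is one of the bilinearity laws of
  \<open>b\<close>.\<close>

lemma tensor_kernel_le_ker: "K \<subseteq> lift.ker"
  unfolding tensor_kernel_def
proof (rule F.span_is_subset [OF _ lift.ker_is_submodule])
  show "tensor_relators R M N \<subseteq> lift.ker"
    unfolding tensor_relators_def Let_def lift.ker_def
    by (auto simp: free_lift_pair add_left add_right smult_left smult_right P.r_neg a_minus_def)
qed

text \<open>Representatives of one coset differ by an element of \<open>K\<close>, which the linear
  extension sends to zero.\<close>

lemma tensor_lift_coset:
  assumes f: "f \<in> carrier F"
  shows "tensor_lift R P b (K +>\<^bsub>F\<^esub> f) = free_lift R P b' f"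
proof -
  have eq: "free_lift R P b' g = free_lift R P b' f" if "g \<in> K +>\<^bsub>F\<^esub> f" for g
  proof -
    from that obtain k where k: "k \<in> K" and g: "g = k \<oplus>\<^bsub>F\<^esub> f"
      by (auto simp: a_r_coset_def')
    have "free_lift R P b' k = \<zero>\<^bsub>P\<^esub>"
      using k tensor_kernel_le_ker by (auto simp: lift.ker_def)
    with k f show ?thesis by (simp add: g)
  qed
  \<comment> \<open>The sum in \<open>tensor_lift_def\<close> is \<open>free_lift\<close> of the
    uncurried map, so \<open>THE\<close> asks for the common value of \<open>free_lift\<close> on
    the coset.\<close>
  show ?thesis
    unfolding tensor_lift_def free_lift_def [symmetric]
  proof (rule the_equality)
    show "\<exists>g\<in>K +>\<^bsub>F\<^esub> f. free_lift R P b' f = free_lift R P b' g"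
      using K.a_rcos_self [OF f] by blast
  qed (use eq in blast)
qed

lemma tensor_lift_hom: "tensor_lift R P b \<in> LinearCombinations.module_hom R T P"
  by (auto elim!: tensor_cosetE
      simp: LinearCombinations.module_hom_def tensor_lift_coset tensor_coset_add tensor_coset_smult)

sublocale tensor_lift: mod_hom R T P "tensor_lift R P b"
  by (intro mod_hom.intro mod_hom_axioms.intro T.module_axioms P.module_axioms tensor_lift_hom)

lemma tensor_lift_pure:
  "\<lbrakk>x \<in> carrier M; y \<in> carrier N\<rbrakk> \<Longrightarrow> tensor_lift R P b (pure_tensor R M N x y) = b x y"
  by (simp add: pure_tensor_def tensor_lift_coset free_lift_pair)

end

section \<open>Tensor products of linear maps\<close>

lemma mod_hom_id: "Module.module R M \<Longrightarrow> mod_hom R M M id"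
  by (auto intro!: mod_hom.intro mod_hom_axioms.intro simp: LinearCombinations.module_hom_def)

locale tensor_map_hom = f: mod_hom R M M' f + g: mod_hom R N N' g
  for R :: "('r, 'c) ring_scheme" (structure)
    and M :: "('r, 'm, 'd) module_scheme" (structure)
    and M' :: "('r, 'p, 'e) module_scheme" (structure)
    and N :: "('r, 'n, 'f) module_scheme" (structure)
    and N' :: "('r, 'q, 'g) module_scheme" (structure)
    and f g
begin

sublocale target: tensor_product R M' N' ..

sublocale target_pure: bilinear_map R M' N' "tensor R M' N'" "pure_tensor R M' N'"
  by (rule target.pure_tensor_bilinear)

text \<open>A bilinear map composed with a linear map in each argument is again bilinear, so
  \<open>tensor_map\<close> falls under the universal property.\<close>

sublocale bilinear_map R M N "tensor R M' N'" "\<lambda>x y. pure_tensor R M' N' (f x) (g y)"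
  by unfold_locales
    (simp_all add: target_pure.add_left target_pure.add_right target_pure.smult_left
      target_pure.smult_right)

lemma tensor_map_mod_hom: "mod_hom R (tensor R M N) (tensor R M' N') (tensor_map R M' N' f g)"
  unfolding tensor_map_def ..

lemma tensor_map_pure:
  "\<lbrakk>x \<in> carrier M; y \<in> carrier N\<rbrakk> \<Longrightarrow>
    tensor_map R M' N' f g (pure_tensor R M N x y) = pure_tensor R M' N' (f x) (g y)"
  unfolding tensor_map_def by (rule tensor_lift_pure)

end

section \<open>The canonical associativity map\<close>

locale tensor_triple = M: Module.module R M + N: Module.module R N + P: Module.module R P
  for R :: "('r, 'c) ring_scheme" (structure)
    and M :: "('r, 'm, 'd) module_scheme" (structure)
    and N :: "('r, 'n, 'e) module_scheme" (structure)
    and P :: "('r, 'p, 'f) module_scheme" (structure)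
begin

abbreviation "NP \<equiv> tensor R N P"
abbreviation "MNP \<equiv> tensor R M NP"

sublocale MN: tensor_product R M N ..
sublocale NP: tensor_product R N P ..
sublocale MNP: tensor_product R M NP ..
sublocale MN_P: tensor_product R "tensor R M N" P ..

sublocale pure_NP: bilinear_map R N P NP "pure_tensor R N P"
  by (rule NP.pure_tensor_bilinear)

sublocale pure_MNP: bilinear_map R M NP MNP "pure_tensor R M NP"
  by (rule MNP.pure_tensor_bilinear)

lemma nested_pure_bilinear:
  assumes "z \<in> carrier P"
  shows "bilinear_map R M N MNP (\<lambda>x y. pure_tensor R M NP x (pure_tensor R N P y z))"
  using assms
  by unfold_locales
    (simp_all add: pure_MNP.add_left pure_MNP.add_right pure_MNP.smult_left pure_MNP.smult_right
      pure_NP.add_left pure_NP.smult_left)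

text \<open>For fixed \<open>z\<close> the inner map is a lift, hence linear in \<open>t\<close>.
  Linearity in \<open>z\<close> concerns the map being lifted: it is checked on a representative
  \<open>f\<close> of \<open>t\<close>, where the lift is a finite sum and \<open>z\<close> enters
  only through the values of the map.\<close>

lemma tensor_assoc_bilinear:
  "bilinear_map R (tensor R M N) P MNP
    (\<lambda>t z. tensor_lift R MNP (\<lambda>x y. pure_tensor R M NP x (pure_tensor R N P y z)) t)"
proof -
  define b where "b z = (\<lambda>x y. pure_tensor R M NP x (pure_tensor R N P y z))" for z
  have b: "bilinear_map R M N MNP (b z)" if "z \<in> carrier P" for z
    using nested_pure_bilinear [OF that] by (simp add: b_def)
  note hom = bilinear_map.tensor_lift_hom [OF b]
  note coset = bilinear_map.tensor_lift_coset [OF b]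
  have bc: "b z (fst w) (snd w) \<in> carrier MNP"
    if "z \<in> carrier P" "w \<in> carrier M \<times> carrier N" for z w
    using bilinear_map.closed [OF b] that by auto
  have "bilinear_map R (tensor R M N) P MNP (\<lambda>t z. tensor_lift R MNP (b z) t)"
  proof (intro bilinear_map.intro bilinear_map_axioms.intro MN.tensor_module P.module_axioms
      MNP.tensor_module)
    fix t z z' assume t: "t \<in> carrier (tensor R M N)" and z: "z \<in> carrier P" "z' \<in> carrier P"
    from t obtain f where f: "f \<in> carrier MN.F" and t: "t = MN.K +>\<^bsub>MN.F\<^esub> f"
      by (rule MN.tensor_cosetE)
    have "free_lift R MNP (\<lambda>w. b (z \<oplus>\<^bsub>P\<^esub> z') (fst w) (snd w)) f
        = free_lift R MNP (\<lambda>w. b z (fst w) (snd w) \<oplus>\<^bsub>MNP\<^esub> b z' (fst w) (snd w)) f"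
      using z by (intro MNP.T.free_lift_cong [OF f])
        (auto simp: b_def pure_MNP.add_right pure_NP.add_right)
    also have "\<dots> = free_lift R MNP (\<lambda>w. b z (fst w) (snd w)) f
        \<oplus>\<^bsub>MNP\<^esub> free_lift R MNP (\<lambda>w. b z' (fst w) (snd w)) f"
      using z by (intro MNP.T.free_lift_add [OF f] Pi_I bc)
    finally show "tensor_lift R MNP (b (z \<oplus>\<^bsub>P\<^esub> z')) t
        = tensor_lift R MNP (b z) t \<oplus>\<^bsub>MNP\<^esub> tensor_lift R MNP (b z') t"
      using z f by (simp add: t coset)
  next
    fix r t z
    assume r: "r \<in> carrier R" and t: "t \<in> carrier (tensor R M N)" and z: "z \<in> carrier P"
    from t obtain f where f: "f \<in> carrier MN.F" and t: "t = MN.K +>\<^bsub>MN.F\<^esub> f"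
      by (rule MN.tensor_cosetE)
    have "free_lift R MNP (\<lambda>w. b (r \<odot>\<^bsub>P\<^esub> z) (fst w) (snd w)) f
        = free_lift R MNP (\<lambda>w. r \<odot>\<^bsub>MNP\<^esub> b z (fst w) (snd w)) f"
      using r z by (intro MNP.T.free_lift_cong [OF f])
        (auto simp: b_def pure_MNP.smult_right pure_NP.smult_right)
    also have "\<dots> = r \<odot>\<^bsub>MNP\<^esub> free_lift R MNP (\<lambda>w. b z (fst w) (snd w)) f"
      using r z by (intro MNP.T.free_lift_smult [OF f] Pi_I bc)
    finally show "tensor_lift R MNP (b (r \<odot>\<^bsub>P\<^esub> z)) t = r \<odot>\<^bsub>MNP\<^esub> tensor_lift R MNP (b z) t"
      using r z f by (simp add: t coset)
  \<comment> \<open>What remains is closure and linearity in \<open>t\<close>, which say that the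
    lift for fixed \<open>z\<close> is a homomorphism.\<close>
  qed (use hom in \<open>auto simp: LinearCombinations.module_hom_def Pi_iff\<close>)
  then show ?thesis by (simp add: b_def)
qed

lemma tensor_assoc_mod_hom:
  "mod_hom R (tensor R (tensor R M N) P) MNP (tensor_assoc R M N P)"
proof -
  interpret b: bilinear_map R "tensor R M N" P MNP
    "\<lambda>t z. tensor_lift R MNP (\<lambda>x y. pure_tensor R M NP x (pure_tensor R N P y z)) t"
    by (rule tensor_assoc_bilinear)
  show ?thesis unfolding tensor_assoc_def Let_def ..
qed

lemma tensor_assoc_pure:
  assumes "x \<in> carrier M" "y \<in> carrier N" "z \<in> carrier P"
  shows "tensor_assoc R M N P (pure_tensor R (tensor R M N) P (pure_tensor R M N x y) z)
    = pure_tensor R M NP x (pure_tensor R N P y z)"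
proof -
  interpret b: bilinear_map R "tensor R M N" P MNP
    "\<lambda>t z. tensor_lift R MNP (\<lambda>x y. pure_tensor R M NP x (pure_tensor R N P y z)) t"
    by (rule tensor_assoc_bilinear)
  interpret pure_MN: bilinear_map R M N "tensor R M N" "pure_tensor R M N"
    by (rule MN.pure_tensor_bilinear)
  show ?thesis
    using assms unfolding tensor_assoc_def Let_def
    by (simp add: b.tensor_lift_pure bilinear_map.tensor_lift_pure [OF nested_pure_bilinear])
qed

end

section \<open>The coproduct of an element of square zero\<close>

text \<open>\<open>\<Delta>\<close> is a parameter prescribed only on the carrier, so
  \<open>mat_coproduct n L\<close> becomes an instance by unfolding its definition.\<close>

locale square_zero_coproduct = unital_assoc_algebra R A
  for R :: "('r, 'c) ring_scheme" (structure) and A :: "('r, 'a, 'd) module_scheme" (structure) +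
  fixes L :: 'a and \<Delta> :: "'a \<Rightarrow> ('a \<times> 'a \<Rightarrow> 'r) set"
  assumes L [simp]: "L \<in> carrier A" and LL: "L \<otimes>\<^bsub>A\<^esub> L = \<zero>\<^bsub>A\<^esub>"
    and coproduct: "a \<in> carrier A \<Longrightarrow>
      \<Delta> a = pure_tensor R A A (a \<otimes>\<^bsub>A\<^esub> L) L \<ominus>\<^bsub>tensor R A A\<^esub> pure_tensor R A A L (L \<otimes>\<^bsub>A\<^esub> a)"
begin

sublocale AA: tensor_product R A A ..
sublocale pure: bilinear_map R A A "tensor R A A" "pure_tensor R A A"
  by (rule AA.pure_tensor_bilinear)
sublocale AAA: tensor_triple R A A A ..

abbreviation "\<pi> \<equiv> pure_tensor R A A"

lemma mult_bilinear: "bilinear_map R A A A (\<lambda>a b. a \<otimes>\<^bsub>A\<^esub> b)"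
  by unfold_locales (simp_all add: l_distr r_distr smult_mult_left smult_mult_right)

text \<open>Bilinearity makes \<open>left_action\<close> a lift that can be evaluated on pure
  tensors; \<open>right_action_bilinear\<close> does the same on the other side.\<close>

lemma left_action_bilinear:
  "a \<in> carrier A \<Longrightarrow> bilinear_map R A A (tensor R A A) (\<lambda>b c. \<pi> (a \<otimes>\<^bsub>A\<^esub> b) c)"
  by unfold_locales
    (simp_all add: r_distr smult_mult_right pure.add_left pure.add_right pure.smult_left
      pure.smult_right)

lemma right_action_bilinear:
  "a \<in> carrier A \<Longrightarrow> bilinear_map R A A (tensor R A A) (\<lambda>b c. \<pi> b (c \<otimes>\<^bsub>A\<^esub> a))"
  by unfold_locales
    (simp_all add: l_distr smult_mult_left pure.add_left pure.add_right pure.smult_left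
      pure.smult_right)

section \<open>Linearity and special values of the coproduct\<close>

lemma coproduct_mod_hom: "mod_hom R A (tensor R A A) \<Delta>"
proof (intro mod_hom.intro mod_hom_axioms.intro module_axioms AA.tensor_module)
  show "\<Delta> \<in> LinearCombinations.module_hom R A (tensor R A A)"
    by (simp add: LinearCombinations.module_hom_def coproduct l_distr r_distr smult_mult_left
        smult_mult_right pure.add_left pure.add_right pure.smult_left pure.smult_right
        a_minus_def AA.T.minus_add AA.T.a_ac AA.T.smult_r_distr AA.T.smult_r_minus)
qed

sublocale coproduct: mod_hom R A "tensor R A A" \<Delta>
  by (rule coproduct_mod_hom)

lemma L_mult_L [simp]: "a \<in> carrier A \<Longrightarrow> (a \<otimes>\<^bsub>A\<^esub> L) \<otimes>\<^bsub>A\<^esub> L = \<zero>\<^bsub>A\<^esub>"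
  "a \<in> carrier A \<Longrightarrow> L \<otimes>\<^bsub>A\<^esub> (L \<otimes>\<^bsub>A\<^esub> a) = \<zero>\<^bsub>A\<^esub>"
  by (simp add: m_assoc LL) (simp add: m_assoc [symmetric] LL)

lemma coproduct_L: "\<Delta> L = \<zero>\<^bsub>tensor R A A\<^esub>"
  by (simp add: coproduct LL pure.zero_left pure.zero_right a_minus_def)

text \<open>The first summand contains a L L and vanishes. The surviving factor L a L also appears
  in \<open>coproduct_L_mult\<close>, there on the left and with the opposite sign; this match is
  behind coassociativity.\<close>

lemma coproduct_mult_L:
  "a \<in> carrier A \<Longrightarrow> \<Delta> (a \<otimes>\<^bsub>A\<^esub> L) = \<ominus>\<^bsub>tensor R A A\<^esub> \<pi> L (L \<otimes>\<^bsub>A\<^esub> (a \<otimes>\<^bsub>A\<^esub> L))"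
  by (simp add: coproduct pure.zero_left a_minus_def)

lemma coproduct_L_mult:
  "a \<in> carrier A \<Longrightarrow> \<Delta> (L \<otimes>\<^bsub>A\<^esub> a) = \<pi> (L \<otimes>\<^bsub>A\<^esub> (a \<otimes>\<^bsub>A\<^esub> L)) L"
  by (simp add: coproduct pure.zero_right a_minus_def m_assoc)

section \<open>Coassociativity and the product rule\<close>

lemma coassociative:
  assumes a: "a \<in> carrier A"
  shows "tensor_assoc R A A A (tensor_map R (tensor R A A) A \<Delta> id (\<Delta> a)) =
    tensor_map R A (tensor R A A) id \<Delta> (\<Delta> a)"
proof -
  let ?AA = "tensor R A A" and ?LaL = "L \<otimes>\<^bsub>A\<^esub> (a \<otimes>\<^bsub>A\<^esub> L)"
  interpret \<Delta>_id: tensor_map_hom R A ?AA A A \<Delta> id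
    by (intro tensor_map_hom.intro coproduct_mod_hom mod_hom_id module_axioms)
  interpret id_\<Delta>: tensor_map_hom R A A A ?AA id \<Delta>
    by (intro tensor_map_hom.intro coproduct_mod_hom mod_hom_id module_axioms)
  interpret \<Delta>_id_hom: mod_hom R ?AA "tensor R ?AA A" "tensor_map R ?AA A \<Delta> id"
    by (rule \<Delta>_id.tensor_map_mod_hom)
  interpret id_\<Delta>_hom: mod_hom R ?AA "tensor R A ?AA" "tensor_map R A ?AA id \<Delta>"
    by (rule id_\<Delta>.tensor_map_mod_hom)
  interpret assoc: mod_hom R "tensor R ?AA A" "tensor R A ?AA" "tensor_assoc R A A A"
    by (rule AAA.tensor_assoc_mod_hom)
  \<comment> \<open>The second term of \<open>\<Delta> a\<close> has left factor \<open>L\<close>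
    and is killed by \<open>coproduct_L\<close>. The minus sign comes from
    \<open>coproduct_mult_L\<close> applied to the first term.\<close>
  have "tensor_map R ?AA A \<Delta> id (\<Delta> a) = \<ominus>\<^bsub>tensor R ?AA A\<^esub> pure_tensor R ?AA A (\<pi> L ?LaL) L"
    using a by (simp add: coproduct [OF a] \<Delta>_id.tensor_map_pure coproduct_mult_L coproduct_L
        \<Delta>_id.target_pure.minus_left \<Delta>_id.target_pure.zero_left a_minus_def)
  \<comment> \<open>Now the first term, with right factor \<open>L\<close>, is killed, and the minus
    sign is the one between the two terms of \<open>\<Delta> a\<close>.\<close>
  moreover have "tensor_map R A ?AA id \<Delta> (\<Delta> a)
      = \<ominus>\<^bsub>tensor R A ?AA\<^esub> pure_tensor R A ?AA L (\<pi> ?LaL L)"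
    using a by (simp add: coproduct [OF a] id_\<Delta>.tensor_map_pure coproduct_L_mult coproduct_L
        AAA.pure_MNP.zero_right a_minus_def)
  ultimately show ?thesis
    using a by (simp add: AAA.tensor_assoc_pure)
qed

lemma coproduct_derivation:
  assumes a: "a \<in> carrier A" and b: "b \<in> carrier A"
  shows "\<Delta> (a \<otimes>\<^bsub>A\<^esub> b) = left_action R A a (\<Delta> b) \<oplus>\<^bsub>tensor R A A\<^esub> right_action R A (\<Delta> a) b"
proof -
  let ?T = "tensor R A A"
  interpret l: bilinear_map R A A ?T "\<lambda>x y. \<pi> (a \<otimes>\<^bsub>A\<^esub> x) y"
    using a by (rule left_action_bilinear)
  interpret r: bilinear_map R A A ?T "\<lambda>x y. \<pi> x (y \<otimes>\<^bsub>A\<^esub> b)"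
    using b by (rule right_action_bilinear)
  have "left_action R A a (\<Delta> b) = \<pi> (a \<otimes>\<^bsub>A\<^esub> (b \<otimes>\<^bsub>A\<^esub> L)) L \<ominus>\<^bsub>?T\<^esub> \<pi> (a \<otimes>\<^bsub>A\<^esub> L) (L \<otimes>\<^bsub>A\<^esub> b)"
    using a b by (simp add: left_action_def coproduct l.tensor_lift_pure)
  moreover have "right_action R A (\<Delta> a) b
      = \<pi> (a \<otimes>\<^bsub>A\<^esub> L) (L \<otimes>\<^bsub>A\<^esub> b) \<ominus>\<^bsub>?T\<^esub> \<pi> L (L \<otimes>\<^bsub>A\<^esub> (a \<otimes>\<^bsub>A\<^esub> b))"
    using a b by (simp add: right_action_def coproduct r.tensor_lift_pure m_assoc)
  \<comment> \<open>The inner terms, both the pure tensor of a L and L b, cancel by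
    \<open>r_neg1\<close>; associativity identifies the outer ones with the two terms of the
    coproduct of the product.\<close>
  ultimately show ?thesis
    using a b by (simp add: coproduct a_minus_def m_assoc AA.T.a_assoc AA.T.r_neg1)
qed

lemma inf_unitary_bialgebra: "inf_unitary_bialgebra R A \<Delta> \<zero>"
proof (intro inf_unitary_bialgebra.intro inf_unitary_bialgebra_axioms.intro
    unital_assoc_algebra_axioms)
  fix a b assume "a \<in> carrier A" "b \<in> carrier A"
  \<comment> \<open>The weight term is a zero multiple. Dropping it requires the sum of the two
    actions to lie in the carrier, which holds because that sum is a value of
    \<open>\<Delta>\<close>.\<close>
  then show "\<Delta> (a \<otimes>\<^bsub>A\<^esub> b) = left_action R A a (\<Delta> b) \<oplus>\<^bsub>tensor R A A\<^esub> right_action R A (\<Delta> a) b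
      \<oplus>\<^bsub>tensor R A A\<^esub> \<zero> \<odot>\<^bsub>tensor R A A\<^esub> \<pi> a b"
    using coproduct_derivation coproduct.f_im [of "a \<otimes>\<^bsub>A\<^esub> b"] by simp
qed (simp_all add: coproduct.f_hom coassociative)

section \<open>Convolution and the antipode\<close>

lemma mult_map_coproduct:
  assumes "a \<in> carrier A"
  shows "mult_map R A (\<Delta> a) = \<zero>\<^bsub>A\<^esub>"
proof -
  interpret m: bilinear_map R A A A "\<lambda>a b. a \<otimes>\<^bsub>A\<^esub> b"
    by (rule mult_bilinear)
  show ?thesis
    using assms by (simp add: mult_map_def coproduct m.tensor_lift_pure a_minus_def)
qed

text \<open>Each of the two pure tensors in \<open>\<Delta> a\<close> contributes one product. Both
  orders of \<open>S\<close> and \<open>id\<close> in \<open>is_antipode\<close> are read off from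
  this formula.\<close>

lemma convolution_eq:
  assumes f: "mod_hom R A A f" and g: "mod_hom R A A g" and a: "a \<in> carrier A"
  shows "convolution R A \<Delta> f g a = f (a \<otimes>\<^bsub>A\<^esub> L) \<otimes>\<^bsub>A\<^esub> g L \<ominus>\<^bsub>A\<^esub> f L \<otimes>\<^bsub>A\<^esub> g (L \<otimes>\<^bsub>A\<^esub> a)"
proof -
  interpret m: bilinear_map R A A A "\<lambda>a b. a \<otimes>\<^bsub>A\<^esub> b"
    by (rule mult_bilinear)
  interpret fg: tensor_map_hom R A A A A f g
    using f g by (rule tensor_map_hom.intro)
  interpret fg_hom: mod_hom R "tensor R A A" "tensor R A A" "tensor_map R A A f g"
    by (rule fg.tensor_map_mod_hom)
  show ?thesis
    using a by (simp add: convolution_def mult_map_def coproduct fg.tensor_map_pure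
        m.tensor_lift_pure)
qed

text \<open>In either order the convolution with the identity is, up to sign, a L L - L L a, hence
  zero, and the circular convolution reduces to a - a. The values of \<open>S\<close> are prescribed
  on the carrier, which is where the series gets evaluated.\<close>

lemma is_antipode_uminus:
  assumes S: "\<And>a. a \<in> carrier A \<Longrightarrow> S a = \<ominus>\<^bsub>A\<^esub> a"
  shows "is_antipode R A \<Delta> S"
proof -
  have hom: "S \<in> LinearCombinations.module_hom R A A"
    by (simp add: LinearCombinations.module_hom_def S minus_add smult_r_minus)
  then have S_hom: "mod_hom R A A S"
    by (intro mod_hom.intro mod_hom_axioms.intro module_axioms)
  show ?thesis
    unfolding is_antipode_def circ_convolution_def
    by (simp add: hom S convolution_eq S_hom mod_hom_id module_axioms l_minus r_minus LL
        a_minus_def l_neg r_neg)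
qed

lemma inf_unitary_hopf_algebra: "inf_unitary_hopf_algebra R A \<Delta> \<zero>"
proof (intro inf_unitary_hopf_algebra.intro inf_unitary_hopf_algebra_axioms.intro
    inf_unitary_bialgebra)
  show "\<exists>S. is_antipode R A \<Delta> S"
    using is_antipode_uminus by blast
qed

end

section \<open>The matrix algebra\<close>

lemma module_mat_unital_assoc_algebra:
  "unital_assoc_algebra class_ring (module_mat TYPE('k :: comm_ring_1) n n)"
proof -
  have "Module.module class_ring (module_mat TYPE('k) n n)"
    by (intro moduleI class_cring.is_cring abelian_group_mat)
      (auto simp: module_mat_simps add_smult_distrib_left_mat add_smult_distrib_right_mat)
  moreover have "ring (module_mat TYPE('k) n n)"
    by (intro ringI abelian_group_mat monoidI)
      (auto simp: module_mat_simps add_mult_distrib_mat mult_add_distrib_mat)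
  ultimately show ?thesis
    by (intro unital_assoc_algebra.intro unital_assoc_algebra_axioms.intro)
      (auto simp: module_mat_simps)
qed

lemma mat_coproduct_square_zero:
  fixes L :: "'k :: comm_ring_1 mat"
  assumes "L \<in> carrier_mat n n" "L * L = 0\<^sub>m n n"
  shows "square_zero_coproduct class_ring (module_mat TYPE('k) n n) L (mat_coproduct n L)"
  using assms
  by (intro square_zero_coproduct.intro square_zero_coproduct_axioms.intro
      module_mat_unital_assoc_algebra) (simp_all add: module_mat_simps mat_coproduct_def Let_def)

theorem theorem2p21:
  fixes \<iota> :: "rat \<Rightarrow> 'k :: comm_ring_1" and n :: nat and L :: "'k mat"
  assumes rat_subring: "inj_comm_ring_hom \<iota>"
    and n: "n \<ge> 1"
    and L: "L \<in> carrier_mat n n" "L * L = 0\<^sub>m n n"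
  shows "let R = (class_ring :: 'k ring);
             A = module_mat TYPE('k) n n;
             \<Delta> = mat_coproduct n L;
             D = mult_map R A \<circ> \<Delta>;
             T = (\<lambda>i M. \<iota> (1 / fact i) \<odot>\<^bsub>A\<^esub> ((\<lambda>X. \<ominus>\<^bsub>A\<^esub> D X) ^^ i) M);
             S = (\<lambda>M. \<ominus>\<^bsub>A\<^esub> (\<Oplus>\<^bsub>A\<^esub>i\<in>{i. T i M \<noteq> \<zero>\<^bsub>A\<^esub>}. T i M))
         in inf_unitary_hopf_algebra R A \<Delta> \<zero>\<^bsub>R\<^esub> \<and>
            (\<forall>M\<in>carrier A. finite {i. T i M \<noteq> \<zero>\<^bsub>A\<^esub>}) \<and>
            is_antipode R A \<Delta> S \<and>
            bij_betw S (carrier A) (carrier A)"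
proof -
  define R where "R = (class_ring :: 'k ring)"
  define A where "A = module_mat TYPE('k) n n"
  define \<Delta> where "\<Delta> = mat_coproduct n L"
  define D where "D = mult_map R A \<circ> \<Delta>"
  define T where "T = (\<lambda>i M. \<iota> (1 / fact i) \<odot>\<^bsub>A\<^esub> ((\<lambda>X. \<ominus>\<^bsub>A\<^esub> D X) ^^ i) M)"
  define S where "S = (\<lambda>M. \<ominus>\<^bsub>A\<^esub> (\<Oplus>\<^bsub>A\<^esub>i\<in>{i. T i M \<noteq> \<zero>\<^bsub>A\<^esub>}. T i M))"
  interpret square_zero_coproduct R A L \<Delta>
    unfolding R_def A_def \<Delta>_def by (rule mat_coproduct_square_zero [OF L])
  interpret \<iota>: inj_comm_ring_hom \<iota> by (rule rat_subring)
  \<comment> \<open>Multiplying out the coproduct gives M L L - L L M, and both products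
    vanish.\<close>
  have D: "D M = \<zero>\<^bsub>A\<^esub>" if "M \<in> carrier A" for M
    using mult_map_coproduct [OF that] by (simp add: D_def)
  \<comment> \<open>The iterate of index 0 is the identity even though \<open>D\<close> is zero; all
    later ones vanish.\<close>
  have iterate: "((\<lambda>X. \<ominus>\<^bsub>A\<^esub> D X) ^^ i) M = (if i = 0 then M else \<zero>\<^bsub>A\<^esub>)"
    if "M \<in> carrier A" for i M
    by (induction i) (use that in \<open>auto simp: D\<close>)
  \<comment> \<open>At index 0 the coefficient is the image of 1 under \<open>\<iota>\<close>, hence
    1; at every other index the coefficient multiplies zero.\<close>
  have T: "T i M = (if i = 0 then M else \<zero>\<^bsub>A\<^esub>)" if "M \<in> carrier A" for i M
    using that smult_one [OF that] smult_r_null [of "\<iota> (1 / fact i)"]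
    by (simp add: T_def iterate R_def)
  \<comment> \<open>For zero \<open>M\<close> the term of index 0 vanishes as well, so the support
    is empty rather than \<open>{0}\<close>.\<close>
  have support: "{i. T i M \<noteq> \<zero>\<^bsub>A\<^esub>} = (if M = \<zero>\<^bsub>A\<^esub> then {} else {0})"
    if "M \<in> carrier A" for M
    by (auto simp: T that)
  \<comment> \<open>Both cases of the support give the same formula, since the empty sum is zero,
    which is then \<open>M\<close> itself.\<close>
  have S: "S M = \<ominus>\<^bsub>A\<^esub> M" if "M \<in> carrier A" for M
    unfolding S_def support [OF that] using that by (simp add: T)
  have "bij_betw S (carrier A) (carrier A)"
    \<comment> \<open>Negation is an involution, so \<open>S\<close> is its own inverse on the
      carrier.\<close>
    by (rule bij_betw_byWitness [where f' = S]) (auto simp: S)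
  moreover have "\<forall>M\<in>carrier A. finite {i. T i M \<noteq> \<zero>\<^bsub>A\<^esub>}"
    by (simp add: support)
  ultimately have "inf_unitary_hopf_algebra R A \<Delta> \<zero>\<^bsub>R\<^esub> \<and>
      (\<forall>M\<in>carrier A. finite {i. T i M \<noteq> \<zero>\<^bsub>A\<^esub>}) \<and>
      is_antipode R A \<Delta> S \<and> bij_betw S (carrier A) (carrier A)"
    using inf_unitary_hopf_algebra is_antipode_uminus [OF S] by blast
  then show ?thesis
    unfolding Let_def S_def T_def D_def \<Delta>_def A_def R_def .
qed

end
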